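(* For every integer $n \ge 3$, the differenced floor quotient Möbius function satisfies $$\sum_{\substack{d \mid n \\ d > \sqrt{n}}} \Delta\mu_1(1,d) = \begin{cases} 0 & \text{if } n \text{ is not of the form } s^2 \text{ or } s(s+1) \text{ for an integer } s \geq 1, \\ -\mu_1(1,s) & \text{if } n = s^2 \text{ or } n = s(s+1) \text{ for an integer } s \ge 1. \end{cases}$$ (Note that $s = \lfloor \sqrt{n} \rfloor$ when $n = s^2$ or $n = s(s+1)$.)
   Context: $\mathbb{N}^+ = \{1,2,3,\ldots\}$. For positive integers $d,n$, $d$ is a floor quotient of $n$, written $d \preccurlyeq_1 n$, if $d = \lfloor n/k \rfloor$ for some positive integer $k$; this relation is a partial order on $\mathbb{N}^+$. The floor quotient Möbius function $\mu_1 : \mathbb{N}^+ \times \mathbb{N}^+ \to \mathbb{Z}$ is the unique function with $\mu_1(n,n)=1$ for all $n$, $\mu_1(d,n)=0$ if $d \not\preccurlyeq_1 n$, and $\sum_{m:\, d \preccurlyeq_1 m \preccurlyeq_1 n} \mu_1(d,m) = 0$ for all $d \ne n$. The differenced floor quotient Möbius function is $\Delta\mu_1(1,n) = \mu_1(1,n) - \mu_1(1,n-1)$ for $n \ge 1$, with the convention $\mu_1(1,0) = 0$. The sum runs over positive divisors $d$ of $n$. *)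

theory Defs
  imports Complex_Main
begin

text \<open>The positive integers are the positive elements of \<^typ>\<open>nat\<close>: the relation below
  never holds if one of its arguments is \<open>0\<close>.\<close>

definition floor_quotient :: "nat \<Rightarrow> nat \<Rightarrow> bool" (infix "\<preceq>\<^sub>1" 50) where
  "d \<preceq>\<^sub>1 n \<longleftrightarrow> 0 < d \<and> 0 < n \<and> (\<exists>k>0. int d = \<lfloor>real n / real k\<rfloor>)"

text \<open>The second clause extends a function on pairs of positive integers by \<open>0\<close>, so that the
  clauses determine it on all of \<^typ>\<open>nat\<close> and \<open>\<mu> 1 0 = 0\<close>.  The index set of the sum is
  finite, by \<open>finite_fq_interval\<close> below.\<close>

definition is_fq_mobius :: "(nat \<Rightarrow> nat \<Rightarrow> int) \<Rightarrow> bool" where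
  "is_fq_mobius \<mu> \<longleftrightarrow>
     (\<forall>n>0. \<mu> n n = 1) \<and>
     (\<forall>d n. \<not> d \<preceq>\<^sub>1 n \<longrightarrow> \<mu> d n = 0) \<and>
     (\<forall>d>0. \<forall>n>0. d \<noteq> n \<longrightarrow> (\<Sum>m | d \<preceq>\<^sub>1 m \<and> m \<preceq>\<^sub>1 n. \<mu> d m) = 0)"

definition fq_mobius :: "nat \<Rightarrow> nat \<Rightarrow> int" ("\<mu>\<^sub>1") where
  "\<mu>\<^sub>1 = (THE \<mu>. is_fq_mobius \<mu>)"

text \<open>The function \<open>n \<mapsto> \<Delta>\<mu>\<^sub>1(1,n)\<close> for \<open>n \<ge> 1\<close>; the value at \<open>n = 0\<close> is irrelevant.\<close>

definition fq_mobius_diff :: "nat \<Rightarrow> int" ("\<Delta>\<mu>\<^sub>1") where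
  "\<Delta>\<mu>\<^sub>1 n = \<mu>\<^sub>1 1 n - \<mu>\<^sub>1 1 (n - 1)"

lemma floor_quotient_refl: "0 < n \<Longrightarrow> n \<preceq>\<^sub>1 n"
  unfolding floor_quotient_def by (auto intro!: exI[of _ 1])

lemma floor_quotient_le:
  assumes "d \<preceq>\<^sub>1 n"
  shows "d \<le> n"
proof -
  from assms obtain k where k: "k > 0" "int d = \<lfloor>real n / real k\<rfloor>"
    unfolding floor_quotient_def by blast
  have "d = n div k"
    using k(2) by (simp add: floor_divide_of_nat_eq)
  then show ?thesis by simp
qed

lemma finite_fq_interval: "finite {m. d \<preceq>\<^sub>1 m \<and> m \<preceq>\<^sub>1 n}"
  by (rule finite_subset[of _ "{..n}"]) (auto dest: floor_quotient_le)

lemma fq_interval_split: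
  assumes "d \<preceq>\<^sub>1 n"
  shows "(\<Sum>m | d \<preceq>\<^sub>1 m \<and> m \<preceq>\<^sub>1 n. \<mu> d m)
       = (\<mu> d n :: int) + (\<Sum>m | d \<preceq>\<^sub>1 m \<and> m \<preceq>\<^sub>1 n \<and> m < n. \<mu> d m)"
proof -
  have "0 < n" using assms by (simp add: floor_quotient_def)
  then have "{m. d \<preceq>\<^sub>1 m \<and> m \<preceq>\<^sub>1 n} = insert n {m. d \<preceq>\<^sub>1 m \<and> m \<preceq>\<^sub>1 n \<and> m < n}"
    using assms floor_quotient_refl floor_quotient_le by (auto simp: le_less)
  moreover have "finite {m. d \<preceq>\<^sub>1 m \<and> m \<preceq>\<^sub>1 n \<and> m < n}"
    by (rule finite_subset[OF _ finite_fq_interval]) auto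
  ultimately show ?thesis by simp
qed

function fq_mobius_rec :: "nat \<Rightarrow> nat \<Rightarrow> int" where
  "fq_mobius_rec d n =
     (if \<not> d \<preceq>\<^sub>1 n then 0 else if d = n then 1
      else - (\<Sum>m \<in> {m. d \<preceq>\<^sub>1 m \<and> m \<preceq>\<^sub>1 n \<and> m < n}. fq_mobius_rec d m))"
  by auto
termination
  by (relation "measure snd") auto

declare fq_mobius_rec.simps [simp del]

lemma is_fq_mobius_rec: "is_fq_mobius fq_mobius_rec"
  unfolding is_fq_mobius_def
proof (intro conjI allI impI)
  fix n :: nat assume "0 < n"
  then show "fq_mobius_rec n n = 1"
    by (simp add: fq_mobius_rec.simps floor_quotient_refl)
next
  fix d n assume "\<not> d \<preceq>\<^sub>1 n"
  then show "fq_mobius_rec d n = 0" by (simp add: fq_mobius_rec.simps)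
next
  fix d n :: nat assume dn: "0 < d" "0 < n" "d \<noteq> n"
  show "(\<Sum>m | d \<preceq>\<^sub>1 m \<and> m \<preceq>\<^sub>1 n. fq_mobius_rec d m) = 0"
  proof (cases "d \<preceq>\<^sub>1 n")
    case True
    then show ?thesis
      using dn by (simp add: fq_interval_split fq_mobius_rec.simps[of d n])
  next
    case False
    have "fq_mobius_rec d m = 0" if "d \<preceq>\<^sub>1 m" "m \<preceq>\<^sub>1 n" for m
    proof -
      from that obtain j k where jk: "j > 0" "k > 0" "d = m div j" "m = n div k"
        unfolding floor_quotient_def by (auto simp: floor_divide_of_nat_eq)
      then have "d = n div (k * j)" by (simp add: div_mult2_eq)
      then have "int d = \<lfloor>real n / real (k * j)\<rfloor>"
        by (metis floor_divide_of_nat_eq)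
      moreover have "0 < k * j" using jk by simp
      ultimately have "d \<preceq>\<^sub>1 n" using dn unfolding floor_quotient_def by blast
      with False show ?thesis by simp
    qed
    then show ?thesis by (intro sum.neutral) auto
  qed
qed

lemma is_fq_mobius_unique:
  assumes f: "is_fq_mobius f" and g: "is_fq_mobius g"
  shows "f = g"
proof -
  have "f d n = g d n" for d n
  proof (induction n rule: less_induct)
    case (less n)
    show ?case
    proof (cases "d \<preceq>\<^sub>1 n \<and> d \<noteq> n")
      case True
      then have pos: "0 < d" "0 < n" by (auto simp: floor_quotient_def)
      let ?S = "{m. d \<preceq>\<^sub>1 m \<and> m \<preceq>\<^sub>1 n \<and> m < n}"
      have "f d n + sum (f d) ?S = 0" "g d n + sum (g d) ?S = 0"
        using f g True pos fq_interval_split[of d n f] fq_interval_split[of d n g]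
        unfolding is_fq_mobius_def by auto
      moreover have "sum (f d) ?S = sum (g d) ?S"
        by (rule sum.cong) (auto simp: less)
      ultimately show ?thesis by simp
    next
      case False
      then show ?thesis using f g unfolding is_fq_mobius_def
        by (metis floor_quotient_def)
    qed
  qed
  then show ?thesis by blast
qed

lemma ex1_fq_mobius: "\<exists>!\<mu>. is_fq_mobius \<mu>"
  using is_fq_mobius_rec is_fq_mobius_unique by blast

lemma is_fq_mobius_fq_mobius: "is_fq_mobius \<mu>\<^sub>1"
  unfolding fq_mobius_def by (rule theI'[OF ex1_fq_mobius])

lemma fq_mobius_0: "\<mu>\<^sub>1 1 0 = 0"
  using is_fq_mobius_fq_mobius by (simp add: is_fq_mobius_def floor_quotient_def)

end

theory Submission
  imports Defs
begin

text \<open>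
  Every \<open>m \<ge> 1\<close> has \<open>1 \<preceq>\<^sub>1 m\<close>, so the defining property of \<open>\<mu>\<^sub>1\<close> says that \<open>\<mu>\<^sub>1 1\<close> sums to \<open>0\<close>
  over the set of all floor quotients of \<open>n\<close>, for each \<open>n \<ge> 2\<close>.  The theorem is the difference of
  this equation at \<open>n\<close> and at \<open>n - 1\<close>.

  To compare the two index sets, cut them at the same place.  If \<open>t\<^sup>2 \<le> n \<le> (t+1)\<^sup>2\<close>, then the
  floor quotients of \<open>n\<close> are, without repetition, the large ones \<open>n div k\<close> for \<open>1 \<le> k \<le> t\<close>
  and the initial segment \<open>1, \<dots>, n div (t+1)\<close> (lemma \<open>sum_floor_quotients\<close>).  The two
  inequalities on \<open>n\<close> are weak ones, so if \<open>t\<close> is chosen with \<open>t\<^sup>2 < n \<le> (t+1)\<^sup>2\<close>, the same \<open>t\<close>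
  serves both \<open>n\<close> and \<open>n - 1\<close>.  Now \<open>n div k\<close> and \<open>(n-1) div k\<close> agree unless \<open>k\<close> divides \<open>n\<close>,
  when they differ by one.  Hence the large floor quotients contribute \<open>\<Delta>\<mu>\<^sub>1 (n div k)\<close> for each
  divisor \<open>k \<le> t\<close> of \<open>n\<close>, and \<open>n div k\<close> then runs through the divisors of \<open>n\<close> beyond \<open>sqrt n\<close>.
  The initial segment contributes one boundary term \<open>\<mu>\<^sub>1 1 (n div (t+1))\<close>, and only if \<open>t + 1\<close>
  divides \<open>n\<close>.  As \<open>t\<^sup>2 < n \<le> (t+1)\<^sup>2\<close>, this means that \<open>n\<close> is \<open>t (t+1)\<close> or \<open>(t+1)\<^sup>2\<close>; these are
  the exceptional \<open>n\<close> of the theorem, with \<open>s = n div (t+1)\<close>.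
\<close>

section \<open>The set of floor quotients of an integer\<close>

lemma floor_quotient_iff_div: "d \<preceq>\<^sub>1 n \<longleftrightarrow> 0 < d \<and> (\<exists>k>0. d = n div k)"
proof -
  have "int d = \<lfloor>real n / real k\<rfloor> \<longleftrightarrow> d = n div k" for k
    by (simp add: floor_divide_of_nat_eq)
  then show ?thesis
    unfolding floor_quotient_def by (auto intro: Nat.gr0I)
qed

text \<open>
  For real quotients the gap \<open>n/k - n/(k+1)\<close> can be less than \<open>1\<close> at the top value of \<open>k\<close>, so
  strictness there needs an argument with the integer \<open>q = n div (k+1)\<close>: \<open>(q+1) k\<close> is at most
  \<open>q (k+1)\<close> or at most \<open>k\<^sup>2\<close>, according to which of \<open>k\<close> and \<open>q\<close> is larger.
\<close>

lemma div_Suc_less_div: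
  fixes n k :: nat
  assumes "0 < k" "k * k \<le> n"
  shows "n div Suc k < n div k"
proof -
  define q where "q = n div Suc k"
  have q: "q * Suc k \<le> n"
    unfolding q_def by (rule div_times_less_eq_dividend)
  have "Suc q * k \<le> n"
  proof (cases "k \<le> q")
    case True
    then have "Suc q * k \<le> q * Suc k" by simp
    with q show ?thesis by linarith
  next
    case False
    then have "Suc q * k \<le> k * k" by (intro mult_right_mono) auto
    with assms show ?thesis by linarith
  qed
  then have "Suc q \<le> n div k"
    using assms by (simp add: less_eq_div_iff_mult_less_eq)
  then show ?thesis by (simp add: q_def)
qed

lemma div_strict_antimono:
  fixes n t k l :: nat
  assumes "t * t \<le> n" "0 < k" "k < l" "l \<le> Suc t"
  shows "n div l < n div k"
proof -
  have "k * k \<le> t * t" using assms by (intro mult_mono) auto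
  then have "n div Suc k < n div k"
    using assms by (intro div_Suc_less_div) auto
  moreover have "n div l \<le> n div Suc k"
    using assms by (intro div_le_mono2) auto
  ultimately show ?thesis by linarith
qed

text \<open>
  The witness is \<open>k = n div j\<close>.  The remainder of \<open>n\<close> modulo \<open>j\<close> is less than \<open>j\<close>, and \<open>j \<le> k\<close>
  because \<open>j\<^sup>2 \<le> n\<close>, so it is also the remainder in the division of \<open>n\<close> by \<open>k\<close>.
\<close>

lemma floor_quotient_of_square_le:
  assumes "0 < j" "j * j \<le> n"
  shows "j \<preceq>\<^sub>1 n"
proof -
  define k where "k = n div j"
  have jk: "j \<le> k"
    using assms by (simp add: k_def less_eq_div_iff_mult_less_eq)
  have "n mod j < j" using assms by simp
  moreover have n: "n = k * j + n mod j" by (simp add: k_def)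
  ultimately have "n div k = j"
    using jk by (intro div_nat_eqI) (auto simp: algebra_simps)
  then show ?thesis
    using assms jk unfolding floor_quotient_iff_div by (intro conjI exI[of _ k]) auto
qed

text \<open>
  The upper bound on \<open>n\<close> forces \<open>n div (t+1) \<le> t + 1\<close>.  Hence each \<open>m \<le> n div (t+1)\<close> has
  \<open>m\<^sup>2 \<le> m (t+1) \<le> n\<close> and is a floor quotient: there are no gaps in the lower part.  The lower
  bound makes the quotients \<open>n div k\<close> with \<open>k \<le> t\<close> positive.
\<close>

lemma floor_quotients_eq:
  assumes lower: "t * t \<le> n" and upper: "n \<le> Suc t * Suc t"
  shows "{m. m \<preceq>\<^sub>1 n} = (\<lambda>k. n div k) ` {1..t} \<union> {1..n div Suc t}"
proof (intro equalityI subsetI)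
  fix m assume "m \<in> {m. m \<preceq>\<^sub>1 n}"
  then obtain k where k: "0 < k" "m = n div k" and "0 < m"
    by (auto simp: floor_quotient_iff_div)
  show "m \<in> (\<lambda>k. n div k) ` {1..t} \<union> {1..n div Suc t}"
  proof (cases "k \<le> t")
    case False
    then have "n div k \<le> n div Suc t" by (intro div_le_mono2) auto
    with k \<open>0 < m\<close> show ?thesis by auto
  qed (use k in auto)
next
  fix m assume "m \<in> (\<lambda>k. n div k) ` {1..t} \<union> {1..n div Suc t}"
  then show "m \<in> {m. m \<preceq>\<^sub>1 n}"
  proof
    assume "m \<in> (\<lambda>k. n div k) ` {1..t}"
    then obtain k where k: "1 \<le> k" "k \<le> t" "m = n div k" by auto
    have "k * 1 \<le> t * t" using k by (intro mult_mono) auto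
    then have "0 < m" using k lower by (simp add: div_greater_zero_iff)
    with k show ?thesis
      unfolding mem_Collect_eq floor_quotient_iff_div by (intro conjI exI[of _ k]) auto
  next
    assume "m \<in> {1..n div Suc t}"
    then have m: "0 < m" "m \<le> n div Suc t" by auto
    have "n div Suc t \<le> Suc t"
      using div_le_mono[OF upper, of "Suc t"] by (simp del: mult_Suc mult_Suc_right)
    with m have "m * m \<le> m * Suc t" by (intro mult_left_mono) auto
    also have "\<dots> \<le> n"
      using m by (simp add: less_eq_div_iff_mult_less_eq del: mult_Suc_right)
    finally show ?thesis using m by (simp add: floor_quotient_of_square_le)
  qed
qed

lemma sum_floor_quotients:
  fixes f :: "nat \<Rightarrow> 'a::comm_monoid_add"
  assumes "t * t \<le> n" "n \<le> Suc t * Suc t"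
  shows "(\<Sum>m | m \<preceq>\<^sub>1 n. f m) = (\<Sum>k=1..t. f (n div k)) + (\<Sum>j=1..n div Suc t. f j)"
proof -
  have "inj_on (\<lambda>k. n div k) {1..t}"
  proof (rule linorder_inj_onI)
    fix k l assume "k < l" "k \<in> {1..t}" "l \<in> {1..t}"
    then show "n div k \<noteq> n div l"
      using div_strict_antimono[OF assms(1), of k l] by simp
  qed auto
  moreover have "(\<lambda>k. n div k) ` {1..t} \<inter> {1..n div Suc t} = {}"
  proof (rule ccontr)
    assume "\<not> ?thesis"
    then obtain k where "1 \<le> k" "k \<le> t" "n div k \<le> n div Suc t" by auto
    then show False
      using div_strict_antimono[OF assms(1), of k "Suc t"] by simp
  qed
  ultimately show ?thesis
    unfolding floor_quotients_eq[OF assms]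
    by (subst sum.union_disjoint) (auto simp: sum.reindex)
qed

section \<open>Passing from \<open>n - 1\<close> to \<open>n\<close>\<close>

text \<open>
  The two sides are matched by \<open>k \<mapsto> n div k\<close>, which exchanges the divisors of \<open>n\<close> below \<open>sqrt n\<close>
  with those above it; the condition on \<open>t\<close> says that \<open>t\<close> is the last integer below \<open>sqrt n\<close>.
\<close>

lemma sum_large_divisors:
  fixes g :: "nat \<Rightarrow> 'a::comm_monoid_add"
  assumes lower: "t * t < n" and upper: "n \<le> Suc t * Suc t"
  shows "(\<Sum>d | d dvd n \<and> n < d * d. g d) = (\<Sum>k | k \<in> {1..t} \<and> k dvd n. g (n div k))"
proof -
  have n: "0 < n" using lower by simp
  have small: "k \<le> t \<longleftrightarrow> k < d" if "d * k = n" for d k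
  proof -
    have pos: "0 < k" using that n by (auto intro: Nat.gr0I)
    have "k < d \<longleftrightarrow> k * k < n"
      using pos by (simp flip: that)
    also have "\<dots> \<longleftrightarrow> k \<le> t"
    proof
      assume "k \<le> t"
      then have "k * k \<le> t * t" by (intro mult_mono) auto
      with lower show "k * k < n" by linarith
    next
      assume *: "k * k < n"
      show "k \<le> t"
      proof (rule ccontr)
        assume "\<not> k \<le> t"
        then have "Suc t * Suc t \<le> k * k" by (intro mult_mono) auto
        with * upper show False by linarith
      qed
    qed
    finally show ?thesis by simp
  qed
  show ?thesis
  proof (rule sum.reindex_bij_witness[of _ "\<lambda>k. n div k" "\<lambda>d. n div d"])
    fix d assume "d \<in> {d. d dvd n \<and> n < d * d}"
    then obtain k where k: "d * k = n" "n < d * d" by (auto simp: dvd_def)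
    then have pos: "0 < d" "0 < k" using n by (auto intro: Nat.gr0I)
    from k pos have "k < d" by (auto simp flip: k(1))
    with small[OF k(1)] have "k \<le> t" by simp
    with k(1) pos show "n div (n div d) = d" "n div d \<in> {k. k \<in> {1..t} \<and> k dvd n}"
      "g (n div (n div d)) = g d"
      by (auto simp flip: k(1))
  next
    fix k assume "k \<in> {k. k \<in> {1..t} \<and> k dvd n}"
    then obtain d where d: "d * k = n" "1 \<le> k" "k \<le> t" by (auto simp: dvd_def mult.commute)
    then have pos: "0 < d" using n by (auto intro: Nat.gr0I)
    from small[OF d(1)] d have "k < d" by simp
    with d(1,2) pos show "n div (n div k) = k" "n div k \<in> {d. d dvd n \<and> n < d * d}"
      by (auto simp flip: d(1))
  qed
qed

lemma div_minus_one:
  fixes n k :: nat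
  assumes "0 < n"
  shows "(n - 1) div k = (if k dvd n then n div k - 1 else n div k)"
proof -
  obtain m where "n = Suc m" using assms by (cases n) auto
  then show ?thesis by (auto simp: div_Suc dvd_eq_mod_eq_0)
qed

text \<open>
  This holds for every function \<open>f\<close>: it is a statement about how the set of floor quotients
  changes from \<open>n - 1\<close> to \<open>n\<close>.
\<close>

lemma sum_floor_quotients_diff:
  fixes f :: "nat \<Rightarrow> 'a::ab_group_add"
  assumes lower: "t * t < n" and upper: "n \<le> Suc t * Suc t"
  shows "(\<Sum>m | m \<preceq>\<^sub>1 n. f m) - (\<Sum>m | m \<preceq>\<^sub>1 n - 1. f m)
       = (\<Sum>d | d dvd n \<and> n < d * d. f d - f (d - 1))
         + (if Suc t dvd n then f (n div Suc t) else 0)"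
proof -
  have n: "0 < n" using lower by simp
  have "(\<Sum>k=1..t. f (n div k)) - (\<Sum>k=1..t. f ((n - 1) div k))
      = (\<Sum>k=1..t. if k dvd n then f (n div k) - f (n div k - 1) else 0)"
    unfolding sum_subtractf[symmetric] by (intro sum.cong) (auto simp: div_minus_one[OF n] simp del: One_nat_def)
  also have "\<dots> = (\<Sum>k | k \<in> {1..t} \<and> k dvd n. f (n div k) - f (n div k - 1))"
    by (rule sum.inter_filter[symmetric]) simp
  also have "\<dots> = (\<Sum>d | d dvd n \<and> n < d * d. f d - f (d - 1))"
    by (rule sum_large_divisors[OF assms, symmetric])
  finally have large: "(\<Sum>k=1..t. f (n div k)) - (\<Sum>k=1..t. f ((n - 1) div k)) = \<dots>" .
  have small: "(\<Sum>j=1..n div Suc t. f j) - (\<Sum>j=1..(n - 1) div Suc t. f j)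
      = (if Suc t dvd n then f (n div Suc t) else 0)"
  proof (cases "Suc t dvd n")
    case True
    then obtain c where "n div Suc t = Suc c"
      using n by (metis dvd_div_eq_0_iff gr0_conv_Suc gr0I less_numeral_extra(3))
    moreover from this have "(n - 1) div Suc t = c"
      using True n by (simp only: div_minus_one) simp
    ultimately show ?thesis using True by simp
  next
    case False
    then show ?thesis by (simp add: div_minus_one[OF n] del: One_nat_def)
  qed
  have "(\<Sum>m | m \<preceq>\<^sub>1 n - 1. f m)
      = (\<Sum>k=1..t. f ((n - 1) div k)) + (\<Sum>j=1..(n - 1) div Suc t. f j)"
    using assms by (intro sum_floor_quotients) linarith+
  moreover have "(\<Sum>m | m \<preceq>\<^sub>1 n. f m)
      = (\<Sum>k=1..t. f (n div k)) + (\<Sum>j=1..n div Suc t. f j)"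
    using assms by (intro sum_floor_quotients) linarith+
  ultimately show ?thesis
    using large small by (simp add: algebra_simps)
qed

section \<open>Sums of the Moebius function over divisors\<close>

lemma sum_fq_mobius_floor_quotients:
  assumes "2 \<le> n"
  shows "(\<Sum>m | m \<preceq>\<^sub>1 n. \<mu>\<^sub>1 1 m) = 0"
proof -
  have "1 \<preceq>\<^sub>1 m" if "m \<preceq>\<^sub>1 n" for m
    using that by (intro floor_quotient_of_square_le) (auto simp: floor_quotient_iff_div)
  then have "{m. m \<preceq>\<^sub>1 n} = {m. 1 \<preceq>\<^sub>1 m \<and> m \<preceq>\<^sub>1 n}" by blast
  then show ?thesis
    using assms is_fq_mobius_fq_mobius unfolding is_fq_mobius_def by auto
qed

lemma exists_sqrt_below:
  fixes n :: nat
  assumes "0 < n"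
  obtains t where "t * t < n" "n \<le> Suc t * Suc t"
proof -
  have "n \<le> Suc n * Suc n" by simp
  then obtain t where t: "n \<le> Suc t * Suc t" "\<forall>u<t. \<not> n \<le> Suc u * Suc u"
    using exists_least_iff[of "\<lambda>t. n \<le> Suc t * Suc t"] by blast
  have "t * t < n"
    using t(2) assms by (cases t) (auto simp: not_le)
  with t that show ?thesis by blast
qed

text \<open>
  The multiple \<open>(t-1)(t+1) = t\<^sup>2 - 1\<close> of \<open>t + 1\<close> is too small to be \<open>n\<close>.  This leaves the next two,
  \<open>t (t+1)\<close> with \<open>s = t\<close> and \<open>(t+1)\<^sup>2\<close> with \<open>s = t + 1\<close>.
\<close>

lemma square_or_pronic_iff:
  fixes n s t :: nat
  assumes lower: "t * t < n" and upper: "n \<le> Suc t * Suc t" and s: "1 \<le> s"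
  shows "n = s\<^sup>2 \<or> n = s * (s + 1) \<longleftrightarrow> Suc t dvd n \<and> n div Suc t = s"
proof
  assume "n = s\<^sup>2 \<or> n = s * (s + 1)"
  then show "Suc t dvd n \<and> n div Suc t = s"
  proof
    assume n: "n = s\<^sup>2"
    have "t < s"
      using lower n by (metis not_less mult_le_mono power2_eq_square)
    moreover have "s \<le> Suc t"
      using upper n by (metis not_le mult_strict_mono' power2_eq_square le0)
    ultimately have "s = Suc t" by simp
    with n show ?thesis
      by (simp add: power2_eq_square del: mult_Suc mult_Suc_right)
  next
    assume n: "n = s * (s + 1)"
    have "t < Suc s"
    proof (rule ccontr)
      assume "\<not> t < Suc s"
      then have "s * (s + 1) \<le> t * t" by (intro mult_le_mono) auto
      with lower n show False by simp
    qed
    moreover have "s < Suc t"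
    proof (rule ccontr)
      assume "\<not> s < Suc t"
      then have "Suc t * (Suc t + 1) \<le> s * (s + 1)" by (intro mult_le_mono) auto
      with upper n show False by simp
    qed
    ultimately have "s = t" by simp
    with n have "n = t * Suc t" by simp
    with \<open>s = t\<close> show ?thesis by (simp del: mult_Suc_right)
  qed
next
  assume "Suc t dvd n \<and> n div Suc t = s"
  then have n: "n = s * Suc t" by (metis dvd_div_mult_self)
  have "s \<le> Suc t"
    using upper unfolding n mult_le_cancel2 by simp
  moreover have "t \<le> s"
  proof (rule ccontr)
    assume "\<not> t \<le> s"
    then obtain u where "t = Suc u" "s \<le> u" by (cases t) auto
    then have "s * Suc t \<le> u * Suc t" by (intro mult_right_mono) auto
    with lower n \<open>t = Suc u\<close> show False by simp
  qed
  ultimately have "s = t \<or> s = Suc t" by linarith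
  with n show "n = s\<^sup>2 \<or> n = s * (s + 1)" by (auto simp: power2_eq_square)
qed

lemma floor_sqrt_square_or_pronic:
  fixes n s :: nat
  assumes "n = s\<^sup>2 \<or> n = s * (s + 1)"
  shows "\<lfloor>sqrt (real n)\<rfloor> = int s"
proof -
  have "s\<^sup>2 \<le> n" "n < (s + 1)\<^sup>2"
    using assms by (auto simp: power2_eq_square)
  then have "(real s)\<^sup>2 \<le> real n" "real n < (real s + 1)\<^sup>2"
    by (metis of_nat_le_iff of_nat_power,
        metis of_nat_less_iff of_nat_power of_nat_Suc Suc_eq_plus1 add.commute)
  then have "real s \<le> sqrt (real n)" "sqrt (real n) < real s + 1"
    by (auto intro: real_le_rsqrt real_less_lsqrt)
  then show ?thesis by (intro floor_unique) auto
qed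

theorem theorem1p7:
  fixes n :: nat
  assumes "n \<ge> 3"
  shows "((\<not> (\<exists>s\<ge>1. n = s\<^sup>2 \<or> n = s * (s + 1))) \<longrightarrow>
            (\<Sum>d | d dvd n \<and> real d > sqrt (real n). \<Delta>\<mu>\<^sub>1 d) = 0) \<and>
         (\<forall>s\<ge>1. n = s\<^sup>2 \<or> n = s * (s + 1) \<longrightarrow>
            (\<Sum>d | d dvd n \<and> real d > sqrt (real n). \<Delta>\<mu>\<^sub>1 d) = - \<mu>\<^sub>1 1 s \<and>
            int s = \<lfloor>sqrt (real n)\<rfloor>)"
proof -
  obtain t where t: "t * t < n" "n \<le> Suc t * Suc t"
    using exists_sqrt_below[of n] assms by auto
  have "sqrt (real n) < real d \<longleftrightarrow> n < d * d" for d
  proof -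
    have "sqrt (real n) < real d \<longleftrightarrow> sqrt (real n) < sqrt (real (d * d))" by simp
    also have "\<dots> \<longleftrightarrow> n < d * d" unfolding real_sqrt_less_iff of_nat_less_iff ..
    finally show ?thesis .
  qed
  then have "(\<Sum>d | d dvd n \<and> real d > sqrt (real n). \<Delta>\<mu>\<^sub>1 d)
      = (\<Sum>d | d dvd n \<and> n < d * d. \<mu>\<^sub>1 1 d - \<mu>\<^sub>1 1 (d - 1))"
    by (simp add: fq_mobius_diff_def)
  \<comment> \<open>The bound \<open>n \<ge> 3\<close> makes the sums over the floor quotients of both \<open>n\<close> and \<open>n - 1\<close> vanish;
      over those of \<open>1\<close> the sum would be \<open>1\<close>.\<close>
  also have "\<dots> = - (if Suc t dvd n then \<mu>\<^sub>1 1 (n div Suc t) else 0)"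
    using sum_floor_quotients_diff[OF t, of "\<mu>\<^sub>1 1"] assms
      sum_fq_mobius_floor_quotients[of n] sum_fq_mobius_floor_quotients[of "n - 1"]
    by simp
  finally have sum: "(\<Sum>d | d dvd n \<and> real d > sqrt (real n). \<Delta>\<mu>\<^sub>1 d) = \<dots>" .
  show ?thesis
  proof (intro conjI impI allI)
    assume *: "\<not> (\<exists>s\<ge>1. n = s\<^sup>2 \<or> n = s * (s + 1))"
    have "\<not> Suc t dvd n"
    proof
      assume dvd: "Suc t dvd n"
      then have "1 \<le> n div Suc t"
        using dvd_imp_le[OF dvd] assms by (simp add: Suc_le_eq div_greater_zero_iff)
      with * square_or_pronic_iff[OF t this] dvd show False by blast
    qed
    then show "(\<Sum>d | d dvd n \<and> real d > sqrt (real n). \<Delta>\<mu>\<^sub>1 d) = 0"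
      using sum by simp
  next
    fix s :: nat assume s: "1 \<le> s" "n = s\<^sup>2 \<or> n = s * (s + 1)"
    then have "Suc t dvd n \<and> n div Suc t = s"
      using square_or_pronic_iff[OF t] by simp
    then show "(\<Sum>d | d dvd n \<and> real d > sqrt (real n). \<Delta>\<mu>\<^sub>1 d) = - \<mu>\<^sub>1 1 s"
      using sum by simp
    show "int s = \<lfloor>sqrt (real n)\<rfloor>"
      using floor_sqrt_square_or_pronic[OF s(2)] by simp
  qed
qed

end
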